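(* Let $u, v, w \in \mathcal{H}$ be the vertices of a triangle in the hyperbolic plane $\mathcal{H}$, and let $A_u, A_v, A_w \in \mathcal{F}$ be cycles defining the three altitudes of the triangle (through $u$, $v$, $w$ respectively). Then $A_u, A_v, A_w$ are linearly dependent in the real vector space $\mathcal{F}$, in the sense that each of the three is a linear combination of the other two, so that together they generate a $2$-dimensional subspace of $\mathcal{F}$.
   Context: Let $\mathcal{F}$ be the real $4$-dimensional vector space of all functions $f:\mathbb{R}^2\to\mathbb{R}$ of the form $f(X)=a\,X\cdot X+b\cdot X+c$ with $a,c\in\mathbb{R}$, $b\in\mathbb{R}^2$, where $\cdot$ is the standard dot product; nonzero elements of $\mathcal{F}$ are called cycles. The hyperbolic plane is the upper half plane $\mathcal{H}=\{(x,y)\in\mathbb{R}^2: y>0\}$. A hyperbolic line is the part lying in $\mathcal{H}$ of a Euclidean line or of a Euclidean circle of positive radius in $\mathbb{R}^2$ that is orthogonal to the $x$-axis (i.e. the upper half of a vertical line, or the upper semicircle of a circle centered on the $x$-axis). A cycle defines a hyperbolic line if its zero set in $\mathbb{R}^2$ is the corresponding Euclidean line or circle; such a cycle is determined by the hyperbolic line up to a nonzero scalar factor. Two hyperbolic lines are orthogonal if the corresponding Euclidean lines or circles are orthogonal in the classical Euclidean sense. A triangle is given by three points of $\mathcal{H}$ not on a common hyperbolic line; its sides are the three hyperbolic lines through pairs of vertices. The altitude through a vertex is the (unique) hyperbolic line passing through that vertex and orthogonal to the opposite side. *)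

theory Defs
  imports "HOL-Analysis.Analysis" "HOL-Library.Function_Algebras"
begin

text \<open>Real-vector-valued functions form a real vector space under the pointwise operations;
  \<^theory>\<open>HOL-Library.Function_Algebras\<close> supplies the additive structure.\<close>

instantiation "fun" :: (type, real_vector) real_vector
begin

definition scaleR_fun_def: "scaleR r f = (\<lambda>x. scaleR r (f x))"

instance
  by standard (simp_all add: scaleR_fun_def fun_eq_iff scaleR_add_right scaleR_add_left)

end

definition cycle_space :: "(real^2 \<Rightarrow> real) set" where
  "cycle_space = {f. \<exists>a b c. f = (\<lambda>X. a * (X \<bullet> X) + b \<bullet> X + c)}"

definition is_cycle :: "(real^2 \<Rightarrow> real) \<Rightarrow> bool" where
  "is_cycle f \<longleftrightarrow> f \<in> cycle_space \<and> f \<noteq> 0"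

definition upper_half_plane :: "(real^2) set" where
  "upper_half_plane = {X. X $ 2 > 0}"

definition x_axis :: "(real^2) set" where
  "x_axis = {X. X $ 2 = 0}"

definition euclidean_line :: "(real^2) set \<Rightarrow> bool" where
  "euclidean_line S \<longleftrightarrow> (\<exists>p d. d \<noteq> 0 \<and> S = range (\<lambda>t. p + t *\<^sub>R d))"

definition euclidean_circle :: "(real^2) set \<Rightarrow> bool" where
  "euclidean_circle S \<longleftrightarrow> (\<exists>c r. r > 0 \<and> S = sphere c r)"

text \<open>Tangent vectors at a point of a line (the multiples of its direction) or of a circle
  (the vectors perpendicular to the radius).\<close>

definition tangent_vectors :: "(real^2) set \<Rightarrow> real^2 \<Rightarrow> (real^2) set" where
  "tangent_vectors S p =
    {v. (\<exists>q d. d \<noteq> 0 \<and> S = range (\<lambda>t. q + t *\<^sub>R d) \<and> v \<in> span {d}) \<or>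
        (\<exists>c r. r > 0 \<and> S = sphere c r \<and> orthogonal v (p - c))}"

text \<open>Classical orthogonality of lines and circles: the two curves meet, with perpendicular
  tangents at their common points. In particular disjoint curves are not orthogonal.\<close>

definition euclidean_orthogonal :: "(real^2) set \<Rightarrow> (real^2) set \<Rightarrow> bool" where
  "euclidean_orthogonal S T \<longleftrightarrow>
    (euclidean_line S \<or> euclidean_circle S) \<and> (euclidean_line T \<or> euclidean_circle T) \<and>
    S \<inter> T \<noteq> {} \<and>
    (\<forall>p \<in> S \<inter> T. \<forall>v \<in> tangent_vectors S p. \<forall>w \<in> tangent_vectors T p. orthogonal v w)"

text \<open>\<open>hyperbolic_carrier S L\<close>: \<open>L\<close> is a hyperbolic line and \<open>S\<close> the Euclidean line or circle
  corresponding to it.\<close>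

definition hyperbolic_carrier :: "(real^2) set \<Rightarrow> (real^2) set \<Rightarrow> bool" where
  "hyperbolic_carrier S L \<longleftrightarrow>
    (euclidean_line S \<or> euclidean_circle S) \<and> euclidean_orthogonal S x_axis \<and>
    L = S \<inter> upper_half_plane"

definition hyperbolic_line :: "(real^2) set \<Rightarrow> bool" where
  "hyperbolic_line L \<longleftrightarrow> (\<exists>S. hyperbolic_carrier S L)"

definition cycle_defines :: "(real^2 \<Rightarrow> real) \<Rightarrow> (real^2) set \<Rightarrow> bool" where
  "cycle_defines f L \<longleftrightarrow> is_cycle f \<and> hyperbolic_carrier {X. f X = 0} L"

definition hyperbolic_orthogonal :: "(real^2) set \<Rightarrow> (real^2) set \<Rightarrow> bool" where
  "hyperbolic_orthogonal L M \<longleftrightarrow>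
    (\<exists>S T. hyperbolic_carrier S L \<and> hyperbolic_carrier T M \<and> euclidean_orthogonal S T)"

definition hyperbolic_triangle :: "real^2 \<Rightarrow> real^2 \<Rightarrow> real^2 \<Rightarrow> bool" where
  "hyperbolic_triangle u v w \<longleftrightarrow>
    {u, v, w} \<subseteq> upper_half_plane \<and> \<not> (\<exists>L. hyperbolic_line L \<and> {u, v, w} \<subseteq> L)"

definition is_side :: "real^2 \<Rightarrow> real^2 \<Rightarrow> (real^2) set \<Rightarrow> bool" where
  "is_side v w M \<longleftrightarrow> hyperbolic_line M \<and> v \<in> M \<and> w \<in> M"

text \<open>\<open>is_altitude u v w L\<close>: \<open>L\<close> is the altitude through \<open>u\<close> of the triangle \<open>u v w\<close>.\<close>

definition is_altitude :: "real^2 \<Rightarrow> real^2 \<Rightarrow> real^2 \<Rightarrow> (real^2) set \<Rightarrow> bool" where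
  "is_altitude u v w L \<longleftrightarrow>
    hyperbolic_line L \<and> u \<in> L \<and> (\<exists>M. is_side v w M \<and> hyperbolic_orthogonal L M)"

lemma subspace_cycle_space: "subspace cycle_space"
proof (rule subspaceI)
  show "0 \<in> cycle_space"
    unfolding cycle_space_def by (auto simp: fun_eq_iff intro!: exI[of _ 0])
next
  fix f g assume "f \<in> cycle_space" "g \<in> cycle_space"
  then obtain a b c a' b' c' where
    "f = (\<lambda>X. a * (X \<bullet> X) + b \<bullet> X + c)" "g = (\<lambda>X. a' * (X \<bullet> X) + b' \<bullet> X + c')"
    unfolding cycle_space_def by blast
  then have "f + g = (\<lambda>X. (a + a') * (X \<bullet> X) + (b + b') \<bullet> X + (c + c'))"
    by (simp add: fun_eq_iff algebra_simps)
  then show "f + g \<in> cycle_space" unfolding cycle_space_def by blast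
next
  fix r :: real and f assume "f \<in> cycle_space"
  then obtain a b c where "f = (\<lambda>X. a * (X \<bullet> X) + b \<bullet> X + c)"
    unfolding cycle_space_def by blast
  then have "r *\<^sub>R f = (\<lambda>X. (r * a) * (X \<bullet> X) + (r *\<^sub>R b) \<bullet> X + (r * c))"
    by (simp add: fun_eq_iff scaleR_fun_def algebra_simps)
  then show "r *\<^sub>R f \<in> cycle_space" unfolding cycle_space_def by blast
qed

end

theory Submission
  imports Defs
begin

text \<open>The cycles \<open>t\<^sub>1 X \<bullet> X + t\<^sub>2 x + t\<^sub>3\<close> of hyperbolic lines are the vectors \<open>t\<close> of \<open>\<real>\<^sup>3\<close> on which
  the discriminant \<open>t\<^sub>2\<^sup>2 - 4 t\<^sub>1 t\<^sub>3\<close> is positive, and two lines are orthogonal iff their vectors are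
  orthogonal for the associated symmetric bilinear form \<open>s \<bullet> J t\<close>. Incidence with a point is linear
  in \<open>t\<close>, given by the dot product with \<open>U = (u \<bullet> u, u\<^sub>1, 1)\<close>. Hence the side through \<open>v\<close> and \<open>w\<close> is a
  multiple of \<open>V \<times> W\<close>, and the altitude through \<open>u\<close> is a multiple of \<open>U \<times> J (V \<times> W)\<close>. These three
  vectors add up to zero by a Jacobi identity. Two of them cannot be parallel: the common altitude
  would be a side perpendicular to both other sides.\<close>

unbundle cross3_syntax

section \<open>Coordinates for the cycles symmetric about the x-axis\<close>

definition lift :: "real^2 \<Rightarrow> real^3" where
  "lift X = vector [X \<bullet> X, X $ 1, 1]"

text \<open>These are the elements of the cycle space without a linear term in the second
  coordinate, that is, those invariant under reflection in the x-axis.\<close>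

definition axial_cycle :: "real^3 \<Rightarrow> real^2 \<Rightarrow> real" where
  "axial_cycle t = (\<lambda>X. t \<bullet> lift X)"

text \<open>The operator \<open>J\<close>, so that \<open>t \<bullet> polar t\<close> is the discriminant.\<close>

definition polar :: "real^3 \<Rightarrow> real^3" where
  "polar t = vector [- 2 * t $ 3, t $ 2, - 2 * t $ 1]"

definition zeros :: "real^3 \<Rightarrow> (real^2) set" where
  "zeros t = {X. axial_cycle t X = 0}"

lemma inner_real2: "x \<bullet> y = x $ 1 * y $ 1 + x $ 2 * y $ 2" for x y :: "real^2"
  by (simp add: inner_vec_def sum_2)

lemma inner_real3: "x \<bullet> y = x $ 1 * y $ 1 + x $ 2 * y $ 2 + x $ 3 * y $ 3" for x y :: "real^3"
  by (simp add: inner_vec_def sum_3)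

lemma axial_cycle_eq:
  "axial_cycle t X = t $ 1 * ((X $ 1)\<^sup>2 + (X $ 2)\<^sup>2) + t $ 2 * X $ 1 + t $ 3"
  by (simp add: axial_cycle_def lift_def inner_real2 inner_real3 power2_eq_square)

lemma inner_polar: "s \<bullet> polar t = s $ 2 * t $ 2 - 2 * (s $ 1 * t $ 3 + s $ 3 * t $ 1)"
  by (simp add: polar_def inner_real3)

lemma in_zeros: "X \<in> zeros t \<longleftrightarrow> t \<bullet> lift X = 0"
  by (simp add: zeros_def axial_cycle_def)

lemma in_zeros_iff:
  "X \<in> zeros t \<longleftrightarrow> t $ 1 * ((X $ 1)\<^sup>2 + (X $ 2)\<^sup>2) + t $ 2 * X $ 1 + t $ 3 = 0"
  by (simp add: zeros_def axial_cycle_eq)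

section \<open>Zero sets as lines and circles, their tangents and their orthogonality\<close>

lemma in_sphere_real2:
  fixes X c :: "real^2"
  assumes "r > 0"
  shows "X \<in> sphere c r \<longleftrightarrow> (X $ 1 - c $ 1)\<^sup>2 + (X $ 2 - c $ 2)\<^sup>2 = r\<^sup>2"
proof -
  have "X \<in> sphere c r \<longleftrightarrow> (norm (X - c))\<^sup>2 = r\<^sup>2"
    using assms by (simp add: dist_norm norm_minus_commute)
  then show ?thesis
    unfolding power2_norm_eq_inner inner_real2 by (simp add: power2_eq_square)
qed

lemma zeros_eq_line:
  assumes "t $ 1 = 0" "0 < t \<bullet> polar t"
  shows "zeros t = range (\<lambda>k. vector [- t $ 3 / t $ 2, 0] + k *\<^sub>R vector [0, 1])"
proof -
  have "t $ 2 \<noteq> 0"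
    using assms by (auto simp: inner_polar)
  then have "X \<in> zeros t \<longleftrightarrow> X = vector [- t $ 3 / t $ 2, 0] + X $ 2 *\<^sub>R vector [0, 1]" for X
    using assms(1) by (auto simp: in_zeros_iff vec_eq_iff forall_2 field_simps)
  moreover have "vector [- t $ 3 / t $ 2, 0] + k *\<^sub>R vector [0, 1] \<in> zeros t" for k
    using assms(1) \<open>t $ 2 \<noteq> 0\<close> by (simp add: in_zeros_iff)
  ultimately show ?thesis
    by blast
qed

text \<open>Completing the square gives centre and radius; the positive discriminant makes the
  radius positive.\<close>

lemma zeros_eq_sphere:
  assumes "t $ 1 \<noteq> 0" "0 < t \<bullet> polar t"
  shows "zeros t = sphere (vector [- t $ 2 / (2 * t $ 1), 0]) (sqrt (t \<bullet> polar t) / (2 * \<bar>t $ 1\<bar>))"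
    (is "_ = sphere ?c ?r")
proof -
  have r: "?r > 0" "?r\<^sup>2 = ((t $ 2)\<^sup>2 - 4 * t $ 1 * t $ 3) / (4 * (t $ 1)\<^sup>2)"
    using assms by (simp_all add: power_divide power_mult_distrib inner_polar power2_eq_square)
  have "X \<in> zeros t \<longleftrightarrow> X \<in> sphere ?c ?r" for X
  proof -
    have "X \<in> sphere ?c ?r \<longleftrightarrow> (X $ 1 + t $ 2 / (2 * t $ 1))\<^sup>2 + (X $ 2)\<^sup>2 - ?r\<^sup>2 = 0"
      using in_sphere_real2[OF r(1), of X ?c] by simp
    also have "(X $ 1 + t $ 2 / (2 * t $ 1))\<^sup>2 + (X $ 2)\<^sup>2 - ?r\<^sup>2 =
        (t $ 1 * ((X $ 1)\<^sup>2 + (X $ 2)\<^sup>2) + t $ 2 * X $ 1 + t $ 3) / t $ 1"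
      unfolding r(2) using assms(1) by (simp add: field_simps power2_eq_square)
    finally show ?thesis
      using assms(1) by (simp add: in_zeros_iff)
  qed
  then show ?thesis
    by blast
qed

lemma line_or_circle_zeros:
  assumes "0 < t \<bullet> polar t"
  shows "euclidean_line (zeros t) \<or> euclidean_circle (zeros t)"
proof (cases "t $ 1 = 0")
  case True
  have "(vector [0, 1] :: real^2) \<noteq> 0"
    by (simp add: vec_eq_iff forall_2)
  then show ?thesis
    using zeros_eq_line[OF True assms] unfolding euclidean_line_def by blast
next
  case False
  then have "sqrt (t \<bullet> polar t) / (2 * \<bar>t $ 1\<bar>) > 0"
    using assms by simp
  then show ?thesis
    using zeros_eq_sphere[OF False assms] unfolding euclidean_circle_def by blast
qed

text \<open>The vector is the gradient of \<open>axial_cycle t\<close> at \<open>p\<close> turned by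
  a right angle, which treats lines and circles uniformly.\<close>

lemma tangent_vector_zeros:
  assumes "0 < t \<bullet> polar t"
  shows "vector [- 2 * t $ 1 * p $ 2, 2 * t $ 1 * p $ 1 + t $ 2] \<in> tangent_vectors (zeros t) p"
    (is "?v \<in> _")
proof (cases "t $ 1 = 0")
  case True
  have "?v = t $ 2 *\<^sub>R vector [0, 1]"
    using True by (simp add: vec_eq_iff forall_2)
  then have "?v \<in> span {vector [0, 1]}"
    by (simp add: span_mul span_base)
  moreover have "(vector [0, 1] :: real^2) \<noteq> 0"
    by (simp add: vec_eq_iff forall_2)
  ultimately show ?thesis
    using zeros_eq_line[OF True assms] unfolding tangent_vectors_def by blast
next
  case False
  have "orthogonal ?v (p - vector [- t $ 2 / (2 * t $ 1), 0])"
    using False by (simp add: orthogonal_def inner_real2 field_simps)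
  moreover have "sqrt (t \<bullet> polar t) / (2 * \<bar>t $ 1\<bar>) > 0"
    using assms False by simp
  ultimately show ?thesis
    using zeros_eq_sphere[OF False assms] unfolding tangent_vectors_def by blast
qed

text \<open>At a common zero the inner product of the two gradients equals
  \<open>s \<bullet> polar t\<close>, so a single intersection point suffices.\<close>

lemma polar_orthogonal:
  assumes "0 < s \<bullet> polar s" "0 < t \<bullet> polar t" "euclidean_orthogonal (zeros s) (zeros t)"
  shows "s \<bullet> polar t = 0"
proof -
  obtain p where p: "p \<in> zeros s" "p \<in> zeros t"
    using assms(3) by (auto simp: euclidean_orthogonal_def)
  then have "orthogonal (vector [- 2 * s $ 1 * p $ 2, 2 * s $ 1 * p $ 1 + s $ 2] :: real^2)
      (vector [- 2 * t $ 1 * p $ 2, 2 * t $ 1 * p $ 1 + t $ 2])"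
    using assms tangent_vector_zeros unfolding euclidean_orthogonal_def by blast
  then have "4 * s $ 1 * t $ 1 * (p $ 2)\<^sup>2 +
      (2 * s $ 1 * p $ 1 + s $ 2) * (2 * t $ 1 * p $ 1 + t $ 2) = 0"
    by (simp add: orthogonal_def inner_real2 power2_eq_square algebra_simps)
  \<comment> \<open>Subtract \<open>2 * t $ 1\<close> times the equation of \<open>p\<close> in
    \<open>zeros s\<close> and \<open>2 * s $ 1\<close> times its equation in
    \<open>zeros t\<close>.\<close>
  with p show ?thesis
    unfolding inner_polar in_zeros_iff by algebra
qed

section \<open>Orthogonality to the x-axis and coordinates of hyperbolic lines\<close>

lemma x_axis_eq_line: "x_axis = range (\<lambda>k. 0 + k *\<^sub>R vector [1, 0])"
proof -
  have "X = 0 + X $ 1 *\<^sub>R vector [1, 0]" if "X $ 2 = 0" for X :: "real^2"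
    using that by (simp add: vec_eq_iff forall_2)
  then show ?thesis
    unfolding x_axis_def by force
qed

lemma euclidean_line_x_axis: "euclidean_line x_axis"
proof -
  have "(vector [1, 0] :: real^2) \<noteq> 0"
    by (simp add: vec_eq_iff forall_2)
  then show ?thesis
    using x_axis_eq_line unfolding euclidean_line_def by blast
qed

lemma tangent_vector_x_axis: "vector [1, 0] \<in> tangent_vectors x_axis p"
proof -
  have "(vector [1, 0] :: real^2) \<noteq> 0"
    by (simp add: vec_eq_iff forall_2)
  then show ?thesis
    using x_axis_eq_line unfolding tangent_vectors_def by (blast intro: span_base)
qed

text \<open>\<open>tangent_vectors\<close> admits every presentation of the set as a line or a
  circle, so all of them are examined; a circle is bounded and cannot be the axis.\<close>

lemma tangent_vectors_x_axis:
  assumes "v \<in> tangent_vectors x_axis p"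
  shows "v $ 2 = 0"
proof -
  consider (line) q d where "x_axis = range (\<lambda>t. q + t *\<^sub>R d)" "v \<in> span {d}"
    | (circle) c r where "r > 0" "x_axis = sphere c r"
    using assms unfolding tangent_vectors_def by blast
  then show ?thesis
  proof cases
    case line
    have "q + 0 *\<^sub>R d \<in> x_axis" "q + 1 *\<^sub>R d \<in> x_axis"
      unfolding line(1) by blast+
    then have "d $ 2 = 0"
      by (simp add: x_axis_def)
    with line(2) show ?thesis
      by (auto simp: span_singleton)
  next
    case circle
    have "bounded x_axis"
      by (simp add: circle(2))
    then obtain B where "\<And>X. X \<in> x_axis \<Longrightarrow> norm X \<le> B"
      by (auto simp: bounded_iff)
    moreover have "vector [\<bar>B\<bar> + 1, 0] \<in> x_axis"
      by (simp add: x_axis_def)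
    ultimately have "norm (vector [\<bar>B\<bar> + 1, 0] :: real^2) \<le> B"
      by blast
    then show ?thesis
      using component_le_norm_cart[of "vector [\<bar>B\<bar> + 1, 0] :: real^2" 1] by simp
  qed
qed

text \<open>Again every presentation counts. A line must be vertical; a circle must be centred on
  the axis, so its radius at a point of the axis is horizontal and the tangent vertical.\<close>

lemma tangent_vectors_zeros_on_axis:
  assumes t: "0 < t \<bullet> polar t" and p: "p \<in> zeros t" "p $ 2 = 0"
    and v: "v \<in> tangent_vectors (zeros t) p"
  shows "v $ 1 = 0"
proof -
  consider (line) q d where "d \<noteq> 0" "zeros t = range (\<lambda>t. q + t *\<^sub>R d)" "v \<in> span {d}"
    | (circle) c r where "r > 0" "zeros t = sphere c r" "orthogonal v (p - c)"
    using v unfolding tangent_vectors_def by blast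
  then show ?thesis
  proof cases
    case line
    \<comment> \<open>The second difference over three equally spaced points isolates the quadratic
      coefficient \<open>t $ 1\<close>.\<close>
    have "q + 0 *\<^sub>R d \<in> zeros t" "q + 1 *\<^sub>R d \<in> zeros t" "q + (-1) *\<^sub>R d \<in> zeros t"
      unfolding line(2) by blast+
    then have eqs: "t $ 1 * ((q $ 1)\<^sup>2 + (q $ 2)\<^sup>2) + t $ 2 * q $ 1 + t $ 3 = 0"
      "t $ 1 * ((q $ 1 + d $ 1)\<^sup>2 + (q $ 2 + d $ 2)\<^sup>2) + t $ 2 * (q $ 1 + d $ 1) + t $ 3 = 0"
      "t $ 1 * ((q $ 1 - d $ 1)\<^sup>2 + (q $ 2 - d $ 2)\<^sup>2) + t $ 2 * (q $ 1 - d $ 1) + t $ 3 = 0"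
      by (simp_all add: in_zeros_iff)
    then have "t $ 1 * ((d $ 1)\<^sup>2 + (d $ 2)\<^sup>2) = 0"
      by algebra
    moreover have "(d $ 1)\<^sup>2 + (d $ 2)\<^sup>2 \<noteq> 0"
      using line(1) by (simp add: sum_power2_eq_zero_iff vec_eq_iff forall_2)
    ultimately have "t $ 1 = 0"
      using mult_eq_0_iff by blast
    moreover from this have "t $ 2 \<noteq> 0"
      using t by (auto simp: inner_polar)
    moreover have "t $ 2 * d $ 1 = 0"
      using eqs(1,2) \<open>t $ 1 = 0\<close> by algebra
    ultimately have "d $ 1 = 0"
      by simp
    with line(3) show ?thesis
      by (auto simp: span_singleton)
  next
    case circle
    \<comment> \<open>Subtracting the equations at opposite extreme points of the circle determines
      the coordinates of its centre.\<close>
    have "c + vector [0, r] \<in> zeros t" "c + vector [0, - r] \<in> zeros t"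
      "c + vector [r, 0] \<in> zeros t" "c + vector [- r, 0] \<in> zeros t"
      unfolding circle(2) by (simp_all add: in_sphere_real2[OF circle(1)] del: mem_sphere)
    then have eqs: "t $ 1 * ((c $ 1)\<^sup>2 + (c $ 2 + r)\<^sup>2) + t $ 2 * c $ 1 + t $ 3 = 0"
      "t $ 1 * ((c $ 1)\<^sup>2 + (c $ 2 - r)\<^sup>2) + t $ 2 * c $ 1 + t $ 3 = 0"
      "t $ 1 * ((c $ 1 + r)\<^sup>2 + (c $ 2)\<^sup>2) + t $ 2 * (c $ 1 + r) + t $ 3 = 0"
      "t $ 1 * ((c $ 1 - r)\<^sup>2 + (c $ 2)\<^sup>2) + t $ 2 * (c $ 1 - r) + t $ 3 = 0"
      by (simp_all add: in_zeros_iff)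
    have "r * (t $ 1 * c $ 2) = 0"
      using eqs(1,2) by algebra
    moreover have "r * (2 * t $ 1 * c $ 1 + t $ 2) = 0"
      using eqs(3,4) by algebra
    ultimately have eqs': "t $ 1 * c $ 2 = 0" "2 * t $ 1 * c $ 1 + t $ 2 = 0"
      using circle(1) by auto
    then have "t $ 1 \<noteq> 0"
      using t by (auto simp: inner_polar)
    then have "c $ 2 = 0"
      using eqs' by simp
    have "(p $ 1 - c $ 1)\<^sup>2 = r\<^sup>2"
      using p(1) \<open>c $ 2 = 0\<close> p(2) unfolding circle(2) in_sphere_real2[OF circle(1)] by simp
    then have "p $ 1 - c $ 1 \<noteq> 0"
      using circle(1) by auto
    then show ?thesis
      using circle(3) \<open>c $ 2 = 0\<close> p(2) by (simp add: orthogonal_def inner_real2)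
  qed
qed

text \<open>On the axis the equation becomes a polynomial in one variable of degree at most two,
  with \<open>t \<bullet> polar t\<close> as its discriminant.\<close>

lemma zeros_meets_x_axis:
  assumes "0 < t \<bullet> polar t"
  shows "zeros t \<inter> x_axis \<noteq> {}"
proof -
  have "\<exists>x. t $ 1 * x\<^sup>2 + t $ 2 * x + t $ 3 = 0"
  proof (cases "t $ 1 = 0")
    case True
    then have "t $ 2 \<noteq> 0"
      using assms by (auto simp: inner_polar)
    with True show ?thesis
      by (intro exI[of _ "- t $ 3 / t $ 2"]) simp
  next
    case False
    define e where "e = sqrt (t \<bullet> polar t)"
    have e: "e * e = t $ 2 * t $ 2 - 4 * t $ 1 * t $ 3"
      using assms by (simp add: e_def inner_polar)
    have "t $ 1 * ((e - t $ 2) / (2 * t $ 1))\<^sup>2 + t $ 2 * ((e - t $ 2) / (2 * t $ 1)) + t $ 3 =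
        (e * e - (t $ 2 * t $ 2 - 4 * t $ 1 * t $ 3)) / (4 * t $ 1)"
      using False by (simp add: field_simps power2_eq_square)
    then show ?thesis
      unfolding e by (intro exI[of _ "(e - t $ 2) / (2 * t $ 1)"]) simp
  qed
  then obtain x where "t $ 1 * x\<^sup>2 + t $ 2 * x + t $ 3 = 0" ..
  then have "vector [x, 0] \<in> zeros t \<inter> x_axis"
    by (simp add: in_zeros_iff x_axis_def)
  then show ?thesis
    by blast
qed

lemma hyperbolic_carrier_zeros:
  assumes "0 < t \<bullet> polar t"
  shows "hyperbolic_carrier (zeros t) (zeros t \<inter> upper_half_plane)"
proof -
  have "orthogonal v w" if "p \<in> zeros t \<inter> x_axis" "v \<in> tangent_vectors (zeros t) p"
    "w \<in> tangent_vectors x_axis p" for p v w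
    using tangent_vectors_zeros_on_axis[OF assms, of p v] tangent_vectors_x_axis[of w p] that
    by (simp add: orthogonal_def inner_real2 x_axis_def)
  then show ?thesis
    using line_or_circle_zeros[OF assms] euclidean_line_x_axis zeros_meets_x_axis[OF assms]
    unfolding hyperbolic_carrier_def euclidean_orthogonal_def by blast
qed

text \<open>Orthogonality at one point of the axis forces vertical tangents there. A line is
  therefore vertical and a circle centred on the axis, and \<open>t\<close> is read off from its
  equation.\<close>

lemma hyperbolic_carrierE:
  assumes "hyperbolic_carrier S L"
  obtains t where "0 < t \<bullet> polar t" "S = zeros t" "L = zeros t \<inter> upper_half_plane"
proof -
  have L: "L = S \<inter> upper_half_plane"
    using assms by (simp add: hyperbolic_carrier_def)
  obtain p where p: "p \<in> S" "p \<in> x_axis"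
    and "\<And>v w. v \<in> tangent_vectors S p \<Longrightarrow> w \<in> tangent_vectors x_axis p \<Longrightarrow> orthogonal v w"
    using assms unfolding hyperbolic_carrier_def euclidean_orthogonal_def by blast
  then have tan: "v $ 1 = 0" if "v \<in> tangent_vectors S p" for v
    using tangent_vector_x_axis[of p] that by (fastforce simp: orthogonal_def inner_real2)
  consider (line) q d where "d \<noteq> 0" "S = range (\<lambda>t. q + t *\<^sub>R d)"
    | (circle) c r where "r > 0" "S = sphere c r"
    using assms
    unfolding hyperbolic_carrier_def euclidean_line_def euclidean_circle_def by blast
  then obtain t where "0 < t \<bullet> polar t" "S = zeros t"
  proof cases
    case line
    then have "d \<in> tangent_vectors S p"
      unfolding tangent_vectors_def by (blast intro: span_base)
    then have d1: "d $ 1 = 0"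
      by (rule tan)
    then have d2: "d $ 2 \<noteq> 0"
      using line(1) by (simp add: vec_eq_iff forall_2)
    let ?t = "vector [0, 1, - q $ 1] :: real^3"
    have "X = q + ((X $ 2 - q $ 2) / d $ 2) *\<^sub>R d" if "X \<in> zeros ?t" for X
      using that d1 d2 by (simp add: in_zeros_iff vec_eq_iff forall_2)
    moreover have "q + k *\<^sub>R d \<in> zeros ?t" for k
      using d1 by (simp add: in_zeros_iff)
    ultimately have "S = zeros ?t"
      unfolding line(2) by blast
    then show ?thesis
      by (intro that[of ?t]) (simp_all add: inner_polar)
  next
    case circle
    \<comment> \<open>The radius turned by a right angle is tangent; as \<open>p\<close> lies on the
      axis, its first component is \<open>c $ 2\<close>.\<close>
    have "orthogonal (vector [- (p $ 2 - c $ 2), p $ 1 - c $ 1]) (p - c)"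
      by (simp add: orthogonal_def inner_real2 algebra_simps)
    with circle have "vector [- (p $ 2 - c $ 2), p $ 1 - c $ 1] \<in> tangent_vectors S p"
      unfolding tangent_vectors_def by blast
    from tan[OF this] p(2) have c2: "c $ 2 = 0"
      by (simp add: x_axis_def)
    \<comment> \<open>Coefficients of the expanded circle equation; the discriminant is four times
      the squared radius.\<close>
    let ?t = "vector [1, - 2 * c $ 1, (c $ 1)\<^sup>2 - r\<^sup>2] :: real^3"
    have "X \<in> S \<longleftrightarrow> X \<in> zeros ?t" for X
      unfolding circle(2) in_sphere_real2[OF circle(1)] in_zeros_iff
      by (simp add: c2 power2_diff algebra_simps)
    moreover have "0 < ?t \<bullet> polar ?t"
      using circle(1) by (simp add: inner_polar power2_eq_square algebra_simps)
    ultimately show ?thesis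
      by (intro that[of ?t]) blast+
  qed
  with L that show ?thesis
    by blast
qed

section \<open>Incidence of points and lines\<close>

text \<open>Two points in the half plane determine the vector of a line up to a factor, so a
  hyperbolic line determines its carrier.\<close>

lemma two_points_of_zeros:
  assumes "0 < t \<bullet> polar t"
  obtains X Y where "X \<in> zeros t \<inter> upper_half_plane" "Y \<in> zeros t \<inter> upper_half_plane" "X \<noteq> Y"
proof (cases "t $ 1 = 0")
  case True
  show ?thesis
  proof (rule that)
    have "vector [- t $ 3 / t $ 2, 0] + k *\<^sub>R vector [0, 1] \<in> zeros t" for k
      unfolding zeros_eq_line[OF True assms] by blast
    note this[of 1] this[of 2]
    then show "vector [- t $ 3 / t $ 2, 0] + 1 *\<^sub>R vector [0, 1] \<in> zeros t \<inter> upper_half_plane"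
      "vector [- t $ 3 / t $ 2, 0] + 2 *\<^sub>R vector [0, 1] \<in> zeros t \<inter> upper_half_plane"
      by (simp_all add: upper_half_plane_def)
  qed (simp add: vec_eq_iff forall_2)
next
  case False
  define c :: "real^2" where "c = vector [- t $ 2 / (2 * t $ 1), 0]"
  define r where "r = sqrt (t \<bullet> polar t) / (2 * \<bar>t $ 1\<bar>)"
  have r: "r > 0"
    using assms False by (simp add: r_def)
  have "zeros t = sphere c r"
    unfolding c_def r_def by (rule zeros_eq_sphere[OF False assms])
  moreover have "c $ 2 = 0"
    by (simp add: c_def)
  ultimately show ?thesis
    using r
    \<comment> \<open>The top of the circle, and a second point from the Pythagorean triple 3, 4,
      5.\<close>
    by (intro that[of "c + vector [0, r]" "c + vector [3 / 5 * r, 4 / 5 * r]"])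
      (simp_all add: in_sphere_real2 upper_half_plane_def vec_eq_iff forall_2 power2_eq_square
        del: mem_sphere)
qed

text \<open>At a zero the discriminant is the squared length of the gradient. Above the axis a
  vanishing gradient would give \<open>t $ 1 = 0\<close>, then \<open>t $ 2 = 0\<close> and finally
  \<open>t $ 3 = 0\<close>.\<close>

lemma inner_polar_pos:
  assumes "t \<noteq> 0" "X \<in> zeros t" "X \<in> upper_half_plane"
  shows "0 < t \<bullet> polar t"
proof -
  have X: "t $ 1 * ((X $ 1)\<^sup>2 + (X $ 2)\<^sup>2) + t $ 2 * X $ 1 + t $ 3 = 0" "X $ 2 > 0"
    using assms by (simp_all add: in_zeros_iff upper_half_plane_def)
  then have eq: "t \<bullet> polar t = (t $ 2 + 2 * t $ 1 * X $ 1)\<^sup>2 + (2 * t $ 1 * X $ 2)\<^sup>2"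
    unfolding inner_polar by algebra
  have "t $ 2 + 2 * t $ 1 * X $ 1 \<noteq> 0 \<or> 2 * t $ 1 * X $ 2 \<noteq> 0"
    using X assms(1) by (auto simp: vec_eq_iff forall_3)
  then show ?thesis
    unfolding eq by (simp only: sum_power2_gt_zero_iff)
qed

text \<open>Parallel lifts are equal because their last coordinate is 1, and positivity of the
  second coordinate lets a point be recovered from its lift.\<close>

lemma cross3_lift_nonzero:
  assumes "X \<in> upper_half_plane" "Y \<in> upper_half_plane" "X \<noteq> Y"
  shows "lift X \<times> lift Y \<noteq> 0"
proof
  assume "lift X \<times> lift Y = 0"
  then have "X $ 1 = Y $ 1" "X \<bullet> X = Y \<bullet> Y"
    by (simp_all add: cross3_def lift_def vec_eq_iff forall_3)
  then have "(X $ 2)\<^sup>2 = (Y $ 2)\<^sup>2"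
    by (simp add: inner_real2 power2_eq_square)
  then have "X $ 2 = Y $ 2"
    using assms by (simp add: upper_half_plane_def)
  with \<open>X $ 1 = Y $ 1\<close> assms(3) show False
    by (simp add: vec_eq_iff forall_2)
qed

text \<open>By the expansion of the double cross product, \<open>t\<close> is parallel to
  \<open>x \<times> y\<close>. This turns two independent incidence or orthogonality conditions into
  an explicit solution.\<close>

lemma orthogonal_to_both_imp_cross3_multiple:
  assumes "t \<bullet> x = 0" "t \<bullet> y = 0" "x \<times> y \<noteq> 0"
  obtains k where "t = k *\<^sub>R (x \<times> y)"
proof -
  have "(x \<times> y) \<times> t = 0"
    using Lagrange[of t x y] cross_skew[of "x \<times> y" t] assms by simp
  then have "t = 0 \<or> (\<exists>k. t = k *\<^sub>R (x \<times> y))"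
    using assms(3) by (auto simp: cross_eq_0 collinear_lemma)
  then show ?thesis
    using that[of 0] that by auto
qed

section \<open>Cycles and their coordinate vectors\<close>

lemma polar_scaleR: "polar (k *\<^sub>R t) = k *\<^sub>R polar t"
  by (simp add: polar_def vec_eq_iff forall_3)

lemma axial_cycle_add: "axial_cycle (s + t) = axial_cycle s + axial_cycle t"
  by (simp add: axial_cycle_def fun_eq_iff inner_add_left)

lemma axial_cycle_scaleR: "axial_cycle (k *\<^sub>R t) = k *\<^sub>R axial_cycle t"
  by (simp add: axial_cycle_def scaleR_fun_def)

lemma axial_cycle_eq_0_iff: "axial_cycle t = 0 \<longleftrightarrow> t = 0"
proof
  assume "axial_cycle t = 0"
  then have "axial_cycle t X = 0" for X
    by simp
  \<comment> \<open>Three values on the axis determine the three coefficients.\<close>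
  note this[of "vector [0, 0]"] this[of "vector [1, 0]"] this[of "vector [- 1, 0]"]
  then show "t = 0"
    by (simp add: axial_cycle_eq vec_eq_iff forall_3)
qed (simp add: axial_cycle_def fun_eq_iff)

text \<open>Sharing a zero set with \<open>axial_cycle s\<close> does not by itself make
  \<open>A\<close> proportional to it, so the coefficients of \<open>A\<close> are treated directly;
  one zero in the half plane yields their positive discriminant.\<close>

lemma cycle_definesE:
  assumes "cycle_defines A L"
  obtains t where "A = axial_cycle t" "0 < t \<bullet> polar t" "hyperbolic_carrier (zeros t) L"
proof -
  obtain a b c where A: "A = (\<lambda>X. a * (X \<bullet> X) + b \<bullet> X + c)" "A \<noteq> 0"
    using assms unfolding cycle_defines_def is_cycle_def cycle_space_def by blast
  have carrier: "hyperbolic_carrier {X. A X = 0} L"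
    using assms by (simp add: cycle_defines_def)
  then obtain s where s: "0 < s \<bullet> polar s" "{X. A X = 0} = zeros s"
    by (metis hyperbolic_carrierE)
  then obtain X where X: "X \<in> zeros s" "X \<in> upper_half_plane"
    by (metis two_points_of_zeros IntD1 IntD2)
  \<comment> \<open>The zero set is symmetric about the axis, so \<open>A\<close> has no linear term in the second coordinate.\<close>
  define Y :: "real^2" where "Y = vector [X $ 1, - X $ 2]"
  have "Y \<in> zeros s"
    using X(1) by (simp add: Y_def in_zeros_iff)
  then have "A X = 0" "A Y = 0"
    using X(1) s(2) by blast+
  then have "b $ 2 * X $ 2 = 0"
    unfolding A(1) Y_def inner_real2 vector_2 by algebra
  then have "b $ 2 = 0"
    using X(2) by (simp add: upper_half_plane_def)
  then have At: "A = axial_cycle (vector [a, b $ 1, c])" (is "_ = axial_cycle ?t")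
    by (simp add: A(1) fun_eq_iff axial_cycle_eq inner_real2 power2_eq_square)
  then have "?t \<noteq> 0"
    using A(2) axial_cycle_eq_0_iff by blast
  moreover have zt: "zeros ?t = {X. A X = 0}"
    by (simp add: zeros_def At)
  ultimately have "0 < ?t \<bullet> polar ?t"
    using inner_polar_pos X s(2) by blast
  with At zt carrier that show ?thesis
    by metis
qed

section \<open>Altitudes in coordinates and their independence\<close>

text \<open>Otherwise \<open>t\<close> would be a multiple of
  \<open>(1, - 2 * X $ 1, X \<bullet> X)\<close>, whose discriminant is negative. Hence passing
  through \<open>X\<close> and being orthogonal to \<open>t\<close> are independent
  conditions.\<close>

lemma cross3_lift_polar_nonzero:
  assumes "0 < t \<bullet> polar t" "X \<in> upper_half_plane"
  shows "lift X \<times> polar t \<noteq> 0"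
proof
  assume "lift X \<times> polar t = 0"
  then have "t $ 2 = - 2 * t $ 1 * X $ 1" "t $ 3 = t $ 1 * ((X $ 1)\<^sup>2 + (X $ 2)\<^sup>2)"
    by (simp_all add: cross3_def lift_def polar_def vec_eq_iff forall_3 inner_real2
        power2_eq_square algebra_simps)
  then have "t \<bullet> polar t = - (2 * t $ 1 * X $ 2)\<^sup>2"
    unfolding inner_polar by algebra
  with assms(1) show False
    by (simp add: not_less)
qed

definition altitude_vector :: "real^2 \<Rightarrow> real^2 \<Rightarrow> real^2 \<Rightarrow> real^3" where
  "altitude_vector u v w = lift u \<times> polar (lift v \<times> lift w)"

lemma altitude_cycle_eq:
  assumes "is_altitude u v w L" "cycle_defines A L"
    and vw: "v \<noteq> w"
  obtains k where "k \<noteq> 0" "A = k *\<^sub>R axial_cycle (altitude_vector u v w)"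
    "altitude_vector u v w \<noteq> 0"
proof -
  obtain t where t: "A = axial_cycle t" "0 < t \<bullet> polar t" "hyperbolic_carrier (zeros t) L"
    using assms(2) by (rule cycle_definesE)
  obtain M S T where u: "u \<in> L" and M: "v \<in> M" "w \<in> M"
    and carriers: "hyperbolic_carrier S L" "hyperbolic_carrier T M" "euclidean_orthogonal S T"
    using assms(1) unfolding is_altitude_def is_side_def hyperbolic_orthogonal_def by blast
  obtain s where s: "0 < s \<bullet> polar s" "S = zeros s" "L = zeros s \<inter> upper_half_plane"
    using carriers(1) by (rule hyperbolic_carrierE)
  obtain m where m: "0 < m \<bullet> polar m" "T = zeros m" "M = zeros m \<inter> upper_half_plane"
    using carriers(2) by (rule hyperbolic_carrierE)
  have L: "L = zeros t \<inter> upper_half_plane"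
    using t(3) by (simp add: hyperbolic_carrier_def)
  \<comment> \<open>The carrier \<open>S\<close> witnessing orthogonality is not given as the zero
    set of \<open>A\<close>. Two points of \<open>L\<close> make \<open>s\<close> and
    \<open>t\<close> multiples of the same \<open>n\<close>, which carries orthogonality over from
    \<open>s\<close> to \<open>t\<close>.\<close>
  obtain X Y where XY: "X \<in> L" "Y \<in> L" "X \<noteq> Y"
    unfolding L using two_points_of_zeros[OF t(2)] by metis
  define n where "n = lift X \<times> lift Y"
  have n: "lift X \<times> lift Y \<noteq> 0"
    using XY L by (intro cross3_lift_nonzero) auto
  have "s \<bullet> lift X = 0" "s \<bullet> lift Y = 0"
    using XY s(3) by (auto simp: in_zeros)
  then obtain i where i: "s = i *\<^sub>R n"
    unfolding n_def using n by (rule orthogonal_to_both_imp_cross3_multiple)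
  have "t \<bullet> lift X = 0" "t \<bullet> lift Y = 0"
    using XY L by (auto simp: in_zeros)
  then obtain j where j: "t = j *\<^sub>R n"
    unfolding n_def using n by (rule orthogonal_to_both_imp_cross3_multiple)
  have "i \<noteq> 0"
    using s(1) i by auto
  have "s \<bullet> polar m = 0"
    using carriers(3) unfolding s(2) m(2) by (rule polar_orthogonal[OF s(1) m(1)])
  then have tm: "t \<bullet> polar m = 0"
    unfolding i j using \<open>i \<noteq> 0\<close> by simp
  have "m \<bullet> lift v = 0" "m \<bullet> lift w = 0" "lift v \<times> lift w \<noteq> 0"
    using M m(3) vw cross3_lift_nonzero[of v w] by (auto simp: in_zeros)
  then obtain l where l: "m = l *\<^sub>R (lift v \<times> lift w)"
    by (rule orthogonal_to_both_imp_cross3_multiple)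
  \<comment> \<open>Stated for \<open>m\<close>, whose discriminant is known to be positive; its
    multiple \<open>lift v \<times> lift w\<close> inherits the conclusion.\<close>
  have "lift u \<times> polar m \<noteq> 0"
    using u L m(1) by (intro cross3_lift_polar_nonzero) auto
  then have P: "altitude_vector u v w \<noteq> 0" and "l \<noteq> 0"
    unfolding altitude_vector_def l polar_scaleR cross_mult_right by auto
  have "t \<bullet> lift u = 0" "t \<bullet> polar (lift v \<times> lift w) = 0"
    using u L tm \<open>l \<noteq> 0\<close> by (auto simp: in_zeros l polar_scaleR)
  then obtain k where k: "t = k *\<^sub>R altitude_vector u v w"
    using P unfolding altitude_vector_def by (rule orthogonal_to_both_imp_cross3_multiple)
  moreover have "k \<noteq> 0"
    using t(2) k by auto
  ultimately show ?thesis
    using that P t(1) by (simp add: axial_cycle_scaleR)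
qed

text \<open>The Jacobi identity for the Lie bracket obtained from the cross product and the symmetric
  operator \<^const>\<open>polar\<close>.\<close>

lemma altitude_vector_sum:
  "altitude_vector u v w + altitude_vector v w u + altitude_vector w u v = 0"
  by (simp add: altitude_vector_def cross3_def polar_def vec_eq_iff forall_3 algebra_simps)

text \<open>A hyperbolic triangle cannot have right angles at both \<open>u\<close> and \<open>v\<close>.\<close>

lemma no_two_right_angles:
  assumes "u \<in> upper_half_plane" "v \<in> upper_half_plane" "w \<in> upper_half_plane"
    and orth: "(lift u \<times> lift v) \<bullet> polar (lift v \<times> lift w) = 0"
      "(lift u \<times> lift v) \<bullet> polar (lift w \<times> lift u) = 0"
  shows "u = v"
proof -
  \<comment> \<open>\<open>g p q\<close> is \<open>2 * p $ 2 * q $ 2\<close> times the hyperbolic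
    cosine of the distance from \<open>p\<close> to \<open>q\<close>.\<close>
  define g :: "real^2 \<Rightarrow> real^2 \<Rightarrow> real"
    where "g p q = (p $ 1 - q $ 1)\<^sup>2 + (p $ 2)\<^sup>2 + (q $ 2)\<^sup>2" for p q
  have pos: "u $ 2 > 0" "v $ 2 > 0" "w $ 2 > 0"
    using assms by (simp_all add: upper_half_plane_def)
  have g: "g u v > 0" "g v w > 0"
    using pos by (simp_all add: g_def add_nonneg_pos)
  \<comment> \<open>The hyperbolic theorem of Pythagoras for right angles at \<open>v\<close> and at
    \<open>u\<close>. Together they force the hyperbolic cosine of the distance from
    \<open>u\<close> to \<open>v\<close> to be 1.\<close>
  have "g u v * g v w = 2 * (v $ 2)\<^sup>2 * g u w" "g u v * g u w = 2 * (u $ 2)\<^sup>2 * g v w"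
    using orth
    by (simp_all add: g_def inner_polar cross3_def lift_def inner_real2 power2_eq_square algebra_simps)
  then have "g v w * ((g u v)\<^sup>2 - (2 * u $ 2 * v $ 2)\<^sup>2) = 0"
    by algebra
  then have "(g u v)\<^sup>2 = (2 * u $ 2 * v $ 2)\<^sup>2"
    using g(2) by simp
  then have "g u v = 2 * u $ 2 * v $ 2"
    using g(1) pos by (simp add: power2_eq_iff_nonneg)
  then have "(u $ 1 - v $ 1)\<^sup>2 + (u $ 2 - v $ 2)\<^sup>2 = 0"
    by (simp add: g_def power2_eq_square algebra_simps)
  then show ?thesis
    by (simp add: sum_power2_eq_zero_iff vec_eq_iff forall_2)
qed

lemma altitude_vectors_parallel:
  assumes H: "u \<in> upper_half_plane" "v \<in> upper_half_plane" "w \<in> upper_half_plane"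
    and nz: "altitude_vector u v w \<noteq> 0"
    and par: "altitude_vector u v w = k *\<^sub>R altitude_vector v w u"
  shows "u = v"
proof (rule ccontr)
  assume "u \<noteq> v"
  let ?P = "altitude_vector u v w" and ?Q = "altitude_vector v w u"
  have P: "?P \<bullet> lift u = 0" "?P \<bullet> polar (lift v \<times> lift w) = 0"
    and Q: "?Q \<bullet> lift v = 0" "?Q \<bullet> polar (lift w \<times> lift u) = 0"
    unfolding altitude_vector_def by (simp_all add: dot_cross_self inner_commute)
  \<comment> \<open>Being proportional to \<open>?Q\<close>, the vector \<open>?P\<close> meets the
    conditions of both altitudes; passing through \<open>u\<close> and \<open>v\<close>, it
    represents their side.\<close>
  have "?P \<bullet> lift v = 0" "?P \<bullet> polar (lift w \<times> lift u) = 0"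
    using Q by (simp_all add: par)
  moreover have "lift u \<times> lift v \<noteq> 0"
    using H \<open>u \<noteq> v\<close> by (intro cross3_lift_nonzero)
  ultimately obtain m where m: "?P = m *\<^sub>R (lift u \<times> lift v)"
    using P(1) orthogonal_to_both_imp_cross3_multiple by metis
  then have "m \<noteq> 0"
    using nz by auto
  then have "(lift u \<times> lift v) \<bullet> polar (lift v \<times> lift w) = 0"
    "(lift u \<times> lift v) \<bullet> polar (lift w \<times> lift u) = 0"
    using P(2) \<open>?P \<bullet> polar (lift w \<times> lift u) = 0\<close> by (simp_all add: m)
  then show False
    using no_two_right_angles H \<open>u \<noteq> v\<close> by blast
qed

section \<open>Distinct vertices and the span of the altitudes\<close>

lemma hyperbolic_line_through:
  assumes "u \<in> upper_half_plane" "v \<in> upper_half_plane"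
  shows "\<exists>L. hyperbolic_line L \<and> u \<in> L \<and> v \<in> L"
proof -
  obtain t where "t \<noteq> 0" "u \<in> zeros t" "v \<in> zeros t"
  proof (cases "u = v")
    case True
    then show ?thesis
      \<comment> \<open>For coincident points the vertical line serves.\<close>
      by (intro that[of "vector [0, 1, - u $ 1]"]) (simp_all add: in_zeros_iff vec_eq_iff forall_3)
  next
    case False
    then show ?thesis
      using cross3_lift_nonzero assms
      by (intro that[of "lift u \<times> lift v"]) (simp_all add: in_zeros dot_cross_self inner_commute)
  qed
  moreover from this have "0 < t \<bullet> polar t"
    using assms by (intro inner_polar_pos)
  ultimately show ?thesis
    using assms hyperbolic_carrier_zeros unfolding hyperbolic_line_def by blast
qed

text \<open>If two vertices coincided, a line through them and the third would contain all
  three.\<close>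

lemma hyperbolic_triangle_distinct:
  assumes "hyperbolic_triangle u v w"
  shows "u \<noteq> v" "v \<noteq> w" "w \<noteq> u"
proof -
  have "u \<in> upper_half_plane" "v \<in> upper_half_plane" "w \<in> upper_half_plane"
    and "\<not> (\<exists>L. hyperbolic_line L \<and> u \<in> L \<and> v \<in> L \<and> w \<in> L)"
    using assms by (auto simp: hyperbolic_triangle_def)
  then show "u \<noteq> v" "v \<noteq> w" "w \<noteq> u"
    using hyperbolic_line_through by metis+
qed

text \<open>The relation is solved for \<open>x\<close>; nonzero \<open>j\<close> and
  \<open>k\<close> allow passing from \<open>y\<close> and \<open>z\<close> to the given
  multiples.\<close>

lemma in_span_pair_of_relation:
  fixes x y z :: "'a::real_vector"
  assumes "x + y + z = 0" "j \<noteq> 0" "k \<noteq> 0"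
  shows "i *\<^sub>R x \<in> span {j *\<^sub>R y, k *\<^sub>R z}"
proof -
  have "x = - y - z"
    using assms(1) by (metis add.assoc eq_neg_iff_add_eq_0 minus_add_distrib add_uminus_conv_diff)
  then have "i *\<^sub>R x = (- i / j) *\<^sub>R (j *\<^sub>R y) + (- i / k) *\<^sub>R (k *\<^sub>R z)"
    using assms(2,3) by (simp add: scaleR_diff_right)
  then show ?thesis
    by (metis span_add span_base span_mul insertI1 insertI2)
qed

theorem mainTheorem1:
  fixes u v w :: "real^2"
    and A_u A_v A_w :: "real^2 \<Rightarrow> real"
    and L_u L_v L_w :: "(real^2) set"
  assumes "hyperbolic_triangle u v w"
    and "is_altitude u v w L_u" and "cycle_defines A_u L_u"
    and "is_altitude v w u L_v" and "cycle_defines A_v L_v"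
    and "is_altitude w u v L_w" and "cycle_defines A_w L_w"
  shows "A_u \<in> span {A_v, A_w} \<and> A_v \<in> span {A_u, A_w} \<and> A_w \<in> span {A_u, A_v} \<and>
    span {A_u, A_v, A_w} \<subseteq> cycle_space \<and> dim (span {A_u, A_v, A_w}) = 2"
proof -
  have H: "u \<in> upper_half_plane" "v \<in> upper_half_plane" "w \<in> upper_half_plane"
    using assms(1) by (auto simp: hyperbolic_triangle_def)
  note distinct = hyperbolic_triangle_distinct[OF assms(1)]
  let ?P = "altitude_vector u v w" and ?Q = "altitude_vector v w u" and ?R = "altitude_vector w u v"
  obtain i where i: "i \<noteq> 0" "A_u = i *\<^sub>R axial_cycle ?P" "?P \<noteq> 0"
    using altitude_cycle_eq[OF assms(2,3) distinct(2)] .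
  obtain j where j: "j \<noteq> 0" "A_v = j *\<^sub>R axial_cycle ?Q" "?Q \<noteq> 0"
    using altitude_cycle_eq[OF assms(4,5) distinct(3)] .
  obtain k where k: "k \<noteq> 0" "A_w = k *\<^sub>R axial_cycle ?R" "?R \<noteq> 0"
    using altitude_cycle_eq[OF assms(6,7) distinct(1)] .
  have sum: "axial_cycle ?P + axial_cycle ?Q + axial_cycle ?R = 0"
    unfolding axial_cycle_add[symmetric] altitude_vector_sum axial_cycle_eq_0_iff ..
  have Au: "A_u \<in> span {A_v, A_w}"
    unfolding i(2) j(2) k(2) using sum j(1) k(1) by (rule in_span_pair_of_relation)
  have Av: "A_v \<in> span {A_u, A_w}"
    unfolding i(2) j(2) k(2) using sum i(1) k(1)
    by (intro in_span_pair_of_relation) (simp_all add: ac_simps)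
  have Aw: "A_w \<in> span {A_u, A_v}"
    unfolding i(2) j(2) k(2) using sum i(1) j(1)
    by (intro in_span_pair_of_relation) (simp_all add: ac_simps)
  have "{A_u, A_v, A_w} \<subseteq> cycle_space"
    using assms(3,5,7) by (auto simp: cycle_defines_def is_cycle_def)
  then have sub: "span {A_u, A_v, A_w} \<subseteq> cycle_space"
    by (rule span_minimal[OF _ subspace_cycle_space])
  \<comment> \<open>This bounds the dimension below by 2: injectivity of \<open>axial_cycle\<close>
    would turn proportional cycles into parallel altitude vectors.\<close>
  have notin: "A_u \<notin> span {A_v}"
  proof
    assume "A_u \<in> span {A_v}"
    then obtain c where "A_u = c *\<^sub>R A_v"
      by (auto simp: span_singleton)
    then have "axial_cycle (i *\<^sub>R ?P + (- c * j) *\<^sub>R ?Q) = 0"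
      unfolding i(2) j(2) axial_cycle_add axial_cycle_scaleR by simp
    then have "i *\<^sub>R ?P = (c * j) *\<^sub>R ?Q"
      by (simp add: axial_cycle_eq_0_iff)
    then have "?P = (c * j / i) *\<^sub>R ?Q"
      using i(1) by (metis divide_inverse_commute real_vector.scale_scale
          real_vector.scale_one left_inverse)
    then show False
      using altitude_vectors_parallel[OF H i(3)] distinct(1) by blast
  qed
  have "A_v \<noteq> 0"
    using j axial_cycle_eq_0_iff by simp
  then have "independent {A_u, A_v}"
    using notin by (simp add: independent_insert)
  moreover have "A_u \<noteq> A_v"
    using notin span_base[of A_v "{A_v}"] by auto
  ultimately have "dim {A_u, A_v} = 2"
    by (simp add: dim_eq_card_independent)
  moreover have "span {A_u, A_v, A_w} = span {A_u, A_v}"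
    using span_redundant[OF Aw] by (simp add: insert_commute)
  ultimately show ?thesis
    using Au Av Aw sub by simp
qed

end
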